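(* There exists an absolute constant $C>0$ such that for every integer $k\geq 1$, every $k$-edge-colouring of the complete graph on $2^k+1$ vertices contains a monochromatic odd cycle of length at most $C k^{3/2}2^{k/2}$. Equivalently, if $L(k)$ denotes the smallest integer such that every $k$-edge-colouring of $K_{2^k+1}$ contains a monochromatic odd cycle of length at most $L(k)$, then $L(k)=O(k^{3/2}2^{k/2})$.
   Context: A $k$-edge-colouring of a graph is an arbitrary assignment of one of $k$ colours to each edge (it need not be proper). A cycle is monochromatic if all its edges have the same colour. An odd cycle is a cycle with an odd number (at least $3$) of edges; its length is its number of edges. *)

theory Defs
  imports "Graph_Theory.Graph_Theory" "HOL-Library.Landau_Symbols"
begin

text \<open>
  Undirected graphs are the symmetric loop-free digraphs of Graph_Theory, in which an undirected
  edge is represented by two opposite arcs. A colouring is a function on the undirected edges,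
  that is, on the two-element sets of end points, so opposite arcs get the same colour.
\<close>

definition uedges :: "'a pair_pre_digraph \<Rightarrow> 'a set set" where
  "uedges G = (\<lambda>(u, v). {u, v}) ` parcs G"

definition edge_colouring :: "nat \<Rightarrow> 'a pair_pre_digraph \<Rightarrow> ('a set \<Rightarrow> nat) \<Rightarrow> bool" where
  "edge_colouring k G c \<longleftrightarrow> (\<forall>e\<in>uedges G. c e < k)"

text \<open>
  The library predicate \<^const>\<open>pre_digraph.cycle\<close> also accepts the closed walk that uses an edge
  back and forth, which is not a cycle of the undirected graph; it has length 2.
\<close>

definition odd_cycle :: "'a pair_pre_digraph \<Rightarrow> ('a \<times> 'a) list \<Rightarrow> bool" where
  "odd_cycle G p \<longleftrightarrow> pre_digraph.cycle (with_proj G) p \<and> odd (length p) \<and> 3 \<le> length p"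

definition monochromatic :: "('a set \<Rightarrow> nat) \<Rightarrow> ('a \<times> 'a) list \<Rightarrow> bool" where
  "monochromatic c p \<longleftrightarrow> (\<exists>i. \<forall>(u, v)\<in>set p. c {u, v} = i)"

text \<open>
  The vertices are natural numbers because a statement cannot quantify over all vertex types;
  every finite graph is isomorphic to a graph of this kind.
\<close>

definition L :: "nat \<Rightarrow> nat" where
  "L k = (LEAST l. \<forall>(G :: nat pair_pre_digraph) c.
     K\<^bsub>2 ^ k + 1\<^esub> (with_proj G) \<longrightarrow> edge_colouring k G c \<longrightarrow>
     (\<exists>p. odd_cycle G p \<and> monochromatic c p \<and> length p \<le> l))"

end

theory Submission
  imports Defs
begin

text \<open>
  If every colour class were bipartite, then giving each vertex the vector of its \<open>k\<close> sides would
  separate all vertices, so there could be at most \<open>2 ^ k\<close> of them. The proof makes this count robust.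
  A graph whose odd closed walks are all long is almost bipartite: its vertices \<open>v\<close> have unit vectors
  \<open>f v\<close> such that adjacent vertices get almost opposite vectors, with inner product at most
  \<open>- (1 - \<epsilon>)\<close>. If the class of colour \<open>i\<close> has such vectors with Gram matrix \<open>Z\<^sub>i\<close>, then
  \<open>P\<^sub>i = (1 + Z\<^sub>i) / 2\<close> plays the role of the matrix that tells whether two vertices are on the same
  side, and the entrywise product \<open>Q\<close> of the \<open>P\<^sub>i\<close> is almost the identity matrix.

  Two facts drive the count. By the Schur product theorem \<open>Q - 2 ^ (-k) J\<close> is positive semidefinite,
  where \<open>J\<close> is the all-ones matrix, so the entries of \<open>Q\<close> on \<open>N\<close> vertices have sum at least
  \<open>N\<^sup>2 / 2 ^ k\<close>. On the other hand every off-diagonal entry of \<open>Q\<close> has a factor at most \<open>\<epsilon> / 2\<close>. Bounding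
  the other factors by 1 would lose too much, but semidefiniteness of the product of \<open>Z\<^sub>i\<close>
  with all \<open>P\<^sub>j\<close>, \<open>j \<noteq> i\<close>, shows that these factors have sum \<open>O(N)\<close> over the edges of colour \<open>i\<close>.
  The off-diagonal sum of \<open>Q\<close> is thus \<open>O(k \<epsilon> N)\<close>, whence \<open>N \<le> 2 ^ k (1 + O(k \<epsilon>))\<close>
  (\<open>card_le_of_near_antipodal_grams\<close>). For \<open>N = 2 ^ k + 1\<close> this forces \<open>\<epsilon>\<close> to be at
  least of order \<open>1 / (k 2 ^ k)\<close>.

  The vectors come from a smooth cover by balls (\<open>gram_of_no_short_odd_walk\<close>). An open
  ball of radius \<open>r\<close> is bipartite if there is no odd closed walk shorter than \<open>2 r\<close>. The coordinate of \<open>v\<close>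
  that belongs to the ball around \<open>c\<close> is, up to normalisation, \<open>(1 + \<beta>) ^ (- dist c v)\<close> minus its value
  at distance \<open>r\<close>, with the sign of the side of \<open>v\<close>. One step
  along an edge changes the coordinates by a relative amount \<open>\<beta>\<close> and flips all signs, which gives
  \<open>\<epsilon> = O(\<beta>\<^sup>2)\<close>; the quadratic gain is what yields the square root of \<open>2 ^ k\<close> in the bound. The
  truncation at distance \<open>r\<close> is harmless once \<open>(1 + \<beta>) ^ (2 r)\<close> is of order \<open>N\<close>, that is, for \<open>r\<close> of order
  \<open>k / \<beta>\<close>. With \<open>\<epsilon>\<close> of order \<open>1 / (k 2 ^ k)\<close> the resulting length is \<open>O(k / \<beta>) = O(k powr (3/2) * 2 powr (k/2))\<close>.
\<close>

section \<open>Positive semidefinite kernels\<close>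

definition psd_on :: "'a set \<Rightarrow> ('a \<Rightarrow> 'a \<Rightarrow> real) \<Rightarrow> bool" where
  "psd_on V K \<longleftrightarrow> (\<forall>x. 0 \<le> (\<Sum>u\<in>V. \<Sum>v\<in>V. x u * x v * K u v))"

definition gram :: "'c set \<Rightarrow> ('c \<Rightarrow> 'a \<Rightarrow> real) \<Rightarrow> 'a \<Rightarrow> 'a \<Rightarrow> real" where
  "gram A f u v = (\<Sum>c\<in>A. f c u * f c v)"

lemma psd_on_cong:
  assumes "psd_on V K" "\<And>u v. u \<in> V \<Longrightarrow> v \<in> V \<Longrightarrow> K u v = K' u v"
  shows "psd_on V K'"
  using assms by (simp add: psd_on_def)

lemma psd_on_add: "psd_on V K \<Longrightarrow> psd_on V K' \<Longrightarrow> psd_on V (\<lambda>u v. K u v + K' u v)"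
  unfolding psd_on_def by (simp add: distrib_left sum.distrib)

lemma psd_on_scale:
  assumes "psd_on V K" "0 \<le> a"
  shows "psd_on V (\<lambda>u v. a * K u v)"
  unfolding psd_on_def
proof
  fix x
  have "(\<Sum>u\<in>V. \<Sum>v\<in>V. x u * x v * (a * K u v)) = a * (\<Sum>u\<in>V. \<Sum>v\<in>V. x u * x v * K u v)"
    by (simp add: sum_distrib_left mult_ac)
  then show "0 \<le> (\<Sum>u\<in>V. \<Sum>v\<in>V. x u * x v * (a * K u v))"
    using assms by (simp add: psd_on_def)
qed

lemma psd_on_one: "psd_on V (\<lambda>u v. 1)"
  unfolding psd_on_def
proof
  fix x :: "'a \<Rightarrow> real"
  have "(\<Sum>u\<in>V. \<Sum>v\<in>V. x u * x v * 1) = (\<Sum>u\<in>V. x u)\<^sup>2"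
    by (simp add: power2_eq_square sum_product)
  then show "0 \<le> (\<Sum>u\<in>V. \<Sum>v\<in>V. x u * x v * 1)" by simp
qed

text \<open>
  The Schur product theorem. As one factor is an explicit sum of the rank-one kernels
  \<open>f c u * f c v\<close>, no diagonalisation is involved: such a factor is absorbed into the test
  vector \<open>x\<close>.
\<close>

lemma psd_on_gram_mult:
  assumes "psd_on V K"
  shows "psd_on V (\<lambda>u v. gram A f u v * K u v)"
  unfolding psd_on_def
proof
  fix x
  have "(\<Sum>u\<in>V. \<Sum>v\<in>V. x u * x v * (gram A f u v * K u v))
      = (\<Sum>u\<in>V. \<Sum>v\<in>V. \<Sum>c\<in>A. (x u * f c u) * (x v * f c v) * K u v)"
    by (simp add: gram_def sum_distrib_left sum_distrib_right mult_ac)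
  also have "\<dots> = (\<Sum>u\<in>V. \<Sum>c\<in>A. \<Sum>v\<in>V. (x u * f c u) * (x v * f c v) * K u v)"
    by (intro sum.cong refl sum.swap)
  also have "\<dots> = (\<Sum>c\<in>A. \<Sum>u\<in>V. \<Sum>v\<in>V. (x u * f c u) * (x v * f c v) * K u v)"
    by (rule sum.swap)
  also have "\<dots> \<ge> 0"
  proof (rule sum_nonneg)
    fix c
    show "0 \<le> (\<Sum>u\<in>V. \<Sum>v\<in>V. (x u * f c u) * (x v * f c v) * K u v)"
      using assms[unfolded psd_on_def, THEN spec, of "\<lambda>u. x u * f c u"] .
  qed
  finally show "0 \<le> (\<Sum>u\<in>V. \<Sum>v\<in>V. x u * x v * (gram A f u v * K u v))" .
qed

lemma psd_on_gram: "psd_on V (gram A f)"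
  by (rule psd_on_cong[OF psd_on_gram_mult[OF psd_on_one]]) simp

lemma psd_on_half_mult:
  assumes "psd_on V K"
  shows "psd_on V (\<lambda>u v. (1 + gram A f u v) / 2 * K u v)"
  by (rule psd_on_cong[OF psd_on_scale[OF psd_on_add[OF assms psd_on_gram_mult[OF assms]], of "1/2"]])
     (auto simp: field_simps)

lemma psd_on_prod_half:
  assumes "finite I"
  shows "psd_on V (\<lambda>u v. \<Prod>i\<in>I. (1 + gram (A i) (f i) u v) / 2)"
  using assms
proof induction
  case empty
  show ?case by (simp add: psd_on_one)
next
  case (insert i I)
  show ?case
    by (rule psd_on_cong[OF psd_on_half_mult[OF insert.IH, of "A i" "f i"]]) (use insert in simp)
qed

text \<open>
  Expanding the product gives \<open>2 ^ (- card I)\<close> times the sum of all products of Gram kernels over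
  subsets of \<open>I\<close>; the empty subset contributes the constant that is subtracted, and each other
  subset contributes a positive semidefinite kernel.
\<close>

lemma psd_on_prod_half_minus:
  assumes "finite I"
  shows "psd_on V (\<lambda>u v. (\<Prod>i\<in>I. (1 + gram (A i) (f i) u v) / 2) - (1/2) ^ card I)"
  using assms
proof induction
  case empty
  show ?case by (simp add: psd_on_def)
next
  case (insert i I)
  have "psd_on V (\<lambda>u v. (1/2) ^ card (insert i I) * gram (A i) (f i) u v)"
    by (intro psd_on_scale psd_on_gram) simp
  from psd_on_add[OF psd_on_half_mult[OF insert.IH, of "A i" "f i"] this]
  show ?case
    by (rule psd_on_cong) (use insert in \<open>simp add: field_simps\<close>)
qed

lemma psd_on_sum_nonneg:
  assumes "psd_on V K"
  shows "0 \<le> (\<Sum>(u, v)\<in>V \<times> V. K u v)"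
  using assms[unfolded psd_on_def, THEN spec, of "\<lambda>_. 1"] by (simp add: sum.cartesian_product)

lemma gram_bound:
  assumes "gram A f u u = 1" "gram A f v v = 1"
  shows "\<bar>gram A f u v\<bar> \<le> 1"
proof -
  have "0 \<le> (\<Sum>c\<in>A. (f c u - f c v)\<^sup>2)" "0 \<le> (\<Sum>c\<in>A. (f c u + f c v)\<^sup>2)"
    by (intro sum_nonneg; simp)+
  moreover have "(\<Sum>c\<in>A. (f c u - f c v)\<^sup>2) = gram A f u u + gram A f v v - 2 * gram A f u v"
    "(\<Sum>c\<in>A. (f c u + f c v)\<^sup>2) = gram A f u u + gram A f v v + 2 * gram A f u v"
    by (simp_all add: gram_def power2_eq_square algebra_simps sum.distrib sum_subtractf
        sum_distrib_left)
  ultimately show ?thesis using assms by linarith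
qed

section \<open>Counting vertices with nearly antipodal representations\<close>

text \<open>
  For \<open>\<epsilon> = 0\<close> this is the bound \<open>2 ^ k\<close> on the number of vertices of a union of \<open>k\<close> bipartite graphs
  that is complete.
  Write \<open>P i = (1 + Z i) / 2\<close>, let \<open>Q\<close> be the product of all \<open>P i\<close>, and \<open>R i\<close> the product of all but
  \<open>P i\<close>. With \<open>T\<close> the off-diagonal sum of \<open>Q\<close>, and \<open>S i\<close> the sum of \<open>R i\<close> over the pairs of colour \<open>i\<close>,
  the proof plays three inequalities against each other:
  \<open>(1 - \<epsilon>) * S i \<le> N + 2 * T\<close> since \<open>Z i * R i\<close> is positive semidefinite,
  \<open>T \<le> \<epsilon> / 2 * (\<Sum>i<k. S i)\<close> since \<open>P i \<le> \<epsilon> / 2\<close> on colour \<open>i\<close>, and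
  \<open>N\<^sup>2 / 2 ^ k \<le> N + T\<close> since \<open>Q\<close> minus \<open>1 / 2 ^ k\<close> is positive semidefinite.
\<close>

lemma card_le_of_near_antipodal_grams:
  fixes \<epsilon> :: real
  assumes V: "finite V" "V \<noteq> {}" and k: "k \<ge> 1" and \<epsilon>: "0 \<le> \<epsilon>" "real k * \<epsilon> \<le> 1/4"
    and unit: "\<And>i v. i < k \<Longrightarrow> v \<in> V \<Longrightarrow> gram (A i) (f i) v v = 1"
    and col: "\<And>u v. u \<in> V \<Longrightarrow> v \<in> V \<Longrightarrow> u \<noteq> v \<Longrightarrow> col u v < k"
    and edge: "\<And>u v. u \<in> V \<Longrightarrow> v \<in> V \<Longrightarrow> u \<noteq> v \<Longrightarrow>
       gram (A (col u v)) (f (col u v)) u v \<le> - (1 - \<epsilon>)"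
  shows "real (card V) \<le> 2 ^ k * (1 + 2 * real k * \<epsilon>)"
proof -
  define N where "N = real (card V)"
  define Z where "Z i = (\<lambda>(u, v). gram (A i) (f i) u v)" for i
  define P where "P i p = (1 + Z i p) / 2" for i p
  define Q where "Q p = (\<Prod>i<k. P i p)" for p
  define R where "R j p = (\<Prod>i\<in>{..<k} - {j}. P i p)" for j p
  define D where "D = {(u, v). u \<in> V \<and> v \<in> V \<and> u \<noteq> v}"
  define F where "F i = {p \<in> D. (\<lambda>(u, v). col u v) p = i}" for i
  define T where "T = (\<Sum>p\<in>D. Q p)"
  define S where "S i = (\<Sum>p\<in>F i. R i p)" for i
  have N: "N > 0" using V by (simp add: N_def card_gt_0_iff)
  have "D \<subseteq> V \<times> V" by (auto simp: D_def)
  then have finD: "finite D" using V by (meson finite_SigmaI finite_subset)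
  have split: "(\<Sum>p\<in>V \<times> V. h p) = (\<Sum>v\<in>V. h (v, v)) + (\<Sum>p\<in>D. h p)" for h :: "'a \<times> 'a \<Rightarrow> real"
  proof -
    have "V \<times> V = (\<lambda>v. (v, v)) ` V \<union> D" by (auto simp: D_def)
    moreover have "(\<lambda>v. (v, v)) ` V \<inter> D = {}" by (auto simp: D_def)
    ultimately have "(\<Sum>p\<in>V \<times> V. h p) = (\<Sum>p\<in>(\<lambda>v. (v, v)) ` V. h p) + (\<Sum>p\<in>D. h p)"
      using finD V by (simp add: sum.union_disjoint)
    also have "(\<Sum>p\<in>(\<lambda>v. (v, v)) ` V. h p) = (\<Sum>v\<in>V. h (v, v))"
      by (subst sum.reindex) (auto simp: inj_on_def)
    finally show ?thesis .
  qed
  have absZ: "\<bar>Z i p\<bar> \<le> 1" if "i < k" "p \<in> D" for i p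
    using that gram_bound[OF unit unit] by (auto simp: Z_def D_def)
  have P0: "0 \<le> P i p" if "i < k" "p \<in> D" for i p
    using absZ[OF that] by (auto simp: P_def)
  have R0: "0 \<le> R j p" if "p \<in> D" for j p
    unfolding R_def by (rule prod_nonneg) (use P0 that in auto)
  have Q0: "0 \<le> Q p" if "p \<in> D" for p
    unfolding Q_def by (rule prod_nonneg) (use P0 that in auto)
  have QR: "Q p = P i p * R i p" if "i < k" for i p
    unfolding Q_def R_def using that by (subst prod.remove[of _ i]) auto
  have diag: "Z i (v, v) = 1" "P i (v, v) = 1" if "i < k" "v \<in> V" for i v
    using unit that by (auto simp: Z_def P_def)
  have diagQ: "Q (v, v) = 1" "R i (v, v) = 1" if "v \<in> V" for v i
    unfolding Q_def R_def by (auto intro!: prod.neutral simp: diag that)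
  have ZF: "Z i p \<le> - (1 - \<epsilon>)" if "p \<in> F i" for i p
    using that edge by (auto simp: F_def D_def Z_def)
  have FD: "F i \<subseteq> D" for i by (auto simp: F_def)
  have T0: "0 \<le> T" unfolding T_def by (intro sum_nonneg Q0)

  have S_le: "S i \<le> 2 * N + 4 * T" if i: "i < k" for i
  proof -
    have "psd_on V (\<lambda>u v. gram (A i) (f i) u v *
        (\<Prod>j\<in>{..<k} - {i}. (1 + gram (A j) (f j) u v) / 2))"
      by (intro psd_on_gram_mult psd_on_prod_half) simp
    from psd_on_sum_nonneg[OF this] have "0 \<le> (\<Sum>p\<in>V \<times> V. Z i p * R i p)"
      by (simp add: Z_def R_def P_def case_prod_unfold)
    also have "\<dots> = N + (\<Sum>p\<in>D. Z i p * R i p)"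
      by (simp add: split diag diagQ i N_def)
    also have "(\<Sum>p\<in>D. Z i p * R i p) = (\<Sum>p\<in>D - F i. Z i p * R i p) + (\<Sum>p\<in>F i. Z i p * R i p)"
      by (rule sum.subset_diff[OF FD finD])
    also have "(\<Sum>p\<in>F i. Z i p * R i p) \<le> (\<Sum>p\<in>F i. - (1 - \<epsilon>) * R i p)"
      by (intro sum_mono mult_right_mono ZF R0) (use FD in auto)
    also have "\<dots> = - (1 - \<epsilon>) * S i"
      by (simp only: S_def sum_distrib_left)
    \<comment> \<open>Outside colour \<open>i\<close>, \<open>Z i \<le> 1 + Z i = 2 * P i\<close> turns \<open>R i\<close> back into the small product \<open>Q\<close>.\<close>
    also have "(\<Sum>p\<in>D - F i. Z i p * R i p) \<le> (\<Sum>p\<in>D - F i. 2 * Q p)"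
    proof (rule sum_mono)
      fix p assume "p \<in> D - F i"
      then have "Z i p * R i p \<le> (1 + Z i p) * R i p"
        by (intro mult_right_mono R0) auto
      then show "Z i p * R i p \<le> 2 * Q p" by (simp add: QR[OF i] P_def)
    qed
    also have "\<dots> \<le> (\<Sum>p\<in>D. 2 * Q p)"
      by (rule sum_mono2) (use finD Q0 in auto)
    also have "\<dots> = 2 * T" by (simp add: T_def sum_distrib_left)
    finally have 1: "(1 - \<epsilon>) * S i \<le> N + 2 * T" by (simp add: algebra_simps)
    have "\<epsilon> \<le> real k * \<epsilon>" using k \<epsilon> by (simp add: mult_le_cancel_right1)
    then have "1/2 * S i \<le> (1 - \<epsilon>) * S i"
      using \<epsilon> FD by (intro mult_right_mono) (auto simp: S_def intro!: sum_nonneg R0)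
    then show ?thesis using 1 by simp
  qed

  have "T = (\<Sum>i<k. \<Sum>p\<in>F i. Q p)"
    unfolding T_def F_def
    by (rule sum.group[symmetric]) (use finD col in \<open>auto simp: D_def\<close>)
  also have "\<dots> \<le> (\<Sum>i<k. \<epsilon> / 2 * (2 * N + 4 * T))"
  proof (rule sum_mono)
    fix i assume "i \<in> {..<k}"
    then have i: "i < k" by simp
    have "(\<Sum>p\<in>F i. Q p) \<le> (\<Sum>p\<in>F i. \<epsilon> / 2 * R i p)"
    proof (rule sum_mono)
      fix p assume p: "p \<in> F i"
      then show "Q p \<le> \<epsilon> / 2 * R i p"
        unfolding QR[OF i] using ZF[OF p] FD by (intro mult_right_mono R0) (auto simp: P_def)
    qed
    also have "\<dots> = \<epsilon> / 2 * S i" by (simp add: S_def sum_distrib_left)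
    also have "\<dots> \<le> \<epsilon> / 2 * (2 * N + 4 * T)"
      using S_le[OF i] \<epsilon> by (intro mult_left_mono) auto
    finally show "(\<Sum>p\<in>F i. Q p) \<le> \<epsilon> / 2 * (2 * N + 4 * T)" .
  qed
  also have "\<dots> = real k * \<epsilon> * N + 2 * (real k * \<epsilon>) * T" by (simp add: algebra_simps)
  also have "2 * (real k * \<epsilon>) * T \<le> 1/2 * T"
    using \<epsilon> T0 by (intro mult_right_mono) auto
  finally have T_le: "T \<le> 2 * real k * \<epsilon> * N" by simp

  have "psd_on V (\<lambda>u v. (\<Prod>i<k. (1 + gram (A i) (f i) u v) / 2) - (1/2) ^ card {..<k})"
    by (rule psd_on_prod_half_minus) simp
  from psd_on_sum_nonneg[OF this] have "0 \<le> (\<Sum>p\<in>V \<times> V. Q p - (1/2) ^ k)"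
    by (simp add: Z_def Q_def P_def case_prod_unfold)
  also have "\<dots> = N + T - N * N * (1/2) ^ k"
    by (simp add: sum_subtractf split[of Q] diagQ T_def N_def card_cartesian_product)
  finally have "N * N * (1/2) ^ k \<le> N * (1 + 2 * real k * \<epsilon>)"
    using T_le by (simp add: algebra_simps)
  then have "N * (1/2) ^ k \<le> 1 + 2 * real k * \<epsilon>"
    using N by (simp add: mult.assoc)
  then show ?thesis unfolding N_def by (simp add: power_one_over field_simps)
qed

section \<open>Representing graphs without short odd closed walks\<close>

text \<open>
  The vertices of \<open>V\<close> serve both as vertices and as centres of balls. Let \<open>g c v\<close> be the unsigned
  weight of \<open>v\<close> in the ball around \<open>c\<close> and \<open>Z v\<close> the squared length of the vector \<open>g _ v\<close>. Inside a
  ball the two ends of an edge have distances from the centre of different parity, since otherwise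
  the two shortest paths and the edge would form a short odd closed walk. So the signed vectors of
  adjacent vertices have minus the inner product of the unsigned ones, and it remains to see
  that the unsigned vectors of adjacent vertices are close: their squared distance is at most
  \<open>4 * \<beta>\<^sup>2\<close> times the squared length of either of them.
\<close>

lemma gram_of_no_short_odd_walk:
  fixes E :: "'a rel" and \<beta> :: real
  assumes V: "finite V" and E: "E \<subseteq> V \<times> V" "sym E" and \<beta>: "\<beta> > 0"
    and no_odd: "\<And>n u. odd n \<Longrightarrow> n < 2 * r \<Longrightarrow> (u, u) \<notin> E ^^ n"
    and large: "4 * real (card V) \<le> (1 + \<beta>) ^ (2 * r)"
  obtains f :: "'a \<Rightarrow> 'a \<Rightarrow> real"
  where "\<And>v. v \<in> V \<Longrightarrow> gram V f v v = 1"
    and "\<And>u v. (u, v) \<in> E \<Longrightarrow> gram V f u v \<le> - (1 - 2 * \<beta>\<^sup>2)"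
proof -
  \<comment> \<open>The distance in \<open>E\<close> cut off at \<open>r\<close>, so that it is defined without connectedness.\<close>
  define d where "d c v = (LEAST n. n = r \<or> (c, v) \<in> E ^^ n)" for c v
  have d_le: "d c v \<le> r" for c v
    unfolding d_def by (rule Least_le) simp
  have d_walk: "(c, v) \<in> E ^^ d c v" if "d c v < r" for c v
    using LeastI[of "\<lambda>n. n = r \<or> (c, v) \<in> E ^^ n" r] that by (auto simp: d_def)
  have d_self: "d c c = 0" for c
    unfolding d_def by (rule Least_eq_0) simp
  have d_step: "d c v \<le> d c u + 1" if "(u, v) \<in> E" for c u v
  proof (cases "d c u < r")
    case True
    then have "(c, v) \<in> E ^^ (d c u + 1)" using d_walk that by auto
    then show ?thesis unfolding d_def[of c v] by (intro Least_le) simp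
  next
    case False
    then show ?thesis using d_le[of c v] by simp
  qed
  have sym_pow: "(v, u) \<in> E ^^ n" if "(u, v) \<in> E ^^ n" for u v n
    using that
  proof (induction n arbitrary: v)
    case (Suc n)
    then obtain w where "(u, w) \<in> E ^^ n" "(w, v) \<in> E" by auto
    then show ?case using Suc.IH \<open>sym E\<close> by (meson relpow_Suc_I2 symD)
  qed simp
  have d_parity: "odd (d c u + d c v)" if uv: "(u, v) \<in> E" and "d c u < r" "d c v < r" for c u v
  proof (rule ccontr)
    assume "\<not> odd (d c u + d c v)"
    then have "odd (Suc (d c u) + d c v)" by simp
    moreover have "(c, c) \<in> E ^^ (Suc (d c u) + d c v)"
    proof -
      have "(c, u) \<in> E ^^ d c u" "(v, c) \<in> E ^^ d c v" using d_walk sym_pow that by blast+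
      then show ?thesis unfolding relpow_add using uv by auto
    qed
    moreover have "Suc (d c u) + d c v < 2 * r" using that by linarith
    ultimately show False using no_odd by blast
  qed

  define \<theta> where "\<theta> = 1 / (1 + \<beta>)"
  have \<theta>: "0 < \<theta>" "\<theta> < 1" "1 - \<theta> = \<beta> * \<theta>"
    using \<beta> by (auto simp: \<theta>_def field_simps)
  \<comment> \<open>Subtracting the value at distance \<open>r\<close> makes the weight reach 0 there without a jump.\<close>
  define g where "g c v = \<theta> ^ d c v - \<theta> ^ r" for c v
  have g_lip: "\<bar>g c u - g c v\<bar> \<le> \<beta> * \<theta> ^ d c u" if uv: "(u, v) \<in> E" for c u v
  proof -
    have "(v, u) \<in> E" using uv E by (simp add: symD)
    from d_step[OF uv, of c] d_step[OF this, of c]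
    consider "d c v = d c u" | "d c v = d c u + 1" | "d c u = d c v + 1"
      by linarith
    then show ?thesis
    proof cases
      case 1
      then show ?thesis using \<theta> \<beta> by (simp add: g_def)
    next
      case 2
      then have "\<bar>g c u - g c v\<bar> = \<bar>(1 - \<theta>) * \<theta> ^ d c u\<bar>"
        by (simp add: g_def algebra_simps)
      also have "\<dots> = \<beta> * \<theta> * \<theta> ^ d c u" using \<theta> \<beta> by simp
      also have "\<dots> \<le> \<beta> * 1 * \<theta> ^ d c u"
        using \<theta> \<beta> by (intro mult_right_mono mult_left_mono) auto
      finally show ?thesis by simp
    next
      case 3
      then have "\<bar>g c u - g c v\<bar> = \<bar>(1 - \<theta>) * \<theta> ^ d c v\<bar>"
        by (simp add: g_def algebra_simps abs_minus_commute)
      also have "\<dots> = \<beta> * \<theta> ^ d c u" using \<theta> \<beta> 3 by simp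
      finally show ?thesis by simp
    qed
  qed

  define Z where "Z v = (\<Sum>c\<in>V. (g c v)\<^sup>2)" for v
  \<comment> \<open>The constants subtracted in \<open>g\<close> have total square at most 1/4, and the ball
    around \<open>v\<close> itself contributes at least as much to \<open>Z v\<close>.\<close>
  have tail: "real (card V) * \<theta> ^ (2 * r) \<le> 1/4"
    using large \<beta> by (simp add: \<theta>_def power_one_over field_simps)
  have Z_ge: "1/4 \<le> Z v" if v: "v \<in> V" for v
  proof -
    have "1 \<le> real (card V)" using V v by (metis One_nat_def Suc_leI card_gt_0_iff empty_iff of_nat_1 of_nat_mono)
    then have "\<theta> ^ (2 * r) \<le> real (card V) * \<theta> ^ (2 * r)" using \<theta> by (simp add: mult_le_cancel_right1)
    then have "(\<theta> ^ r)\<^sup>2 \<le> (1/2)\<^sup>2" using tail by (simp add: power_mult mult.commute power2_eq_square)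
    then have "\<theta> ^ r \<le> 1/2" by (rule power2_le_imp_le) simp
    then have "(1/2)\<^sup>2 \<le> (g v v)\<^sup>2" by (intro power_mono) (simp_all add: g_def d_self)
    also have "\<dots> \<le> Z v" unfolding Z_def using V v by (intro member_le_sum) auto
    finally show ?thesis by (simp add: power2_eq_square)
  qed
  have diff_le: "(\<Sum>c\<in>V. (g c u - g c v)\<^sup>2) \<le> 4 * \<beta>\<^sup>2 * Z u" if uv: "(u, v) \<in> E" for u v
  proof -
    have "(\<Sum>c\<in>V. (g c u - g c v)\<^sup>2) \<le> (\<Sum>c\<in>V. \<beta>\<^sup>2 * (2 * (g c u)\<^sup>2 + 2 * \<theta> ^ (2 * r)))"
    proof (rule sum_mono)
      fix c
      have "(g c u - g c v)\<^sup>2 \<le> (\<beta> * \<theta> ^ d c u)\<^sup>2"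
        using g_lip[OF uv, of c] \<theta> \<beta> by (intro abs_le_square_iff[THEN iffD1]) auto
      also have "\<dots> = \<beta>\<^sup>2 * (g c u + \<theta> ^ r)\<^sup>2" by (simp add: g_def power_mult_distrib)
      also have "(g c u + \<theta> ^ r)\<^sup>2 \<le> 2 * (g c u)\<^sup>2 + 2 * (\<theta> ^ r)\<^sup>2"
        using sum_squares_bound[of "g c u" "\<theta> ^ r"] by (simp add: power2_sum)
      also have "(\<theta> ^ r)\<^sup>2 = \<theta> ^ (2 * r)" by (simp add: power_mult mult.commute flip: power_mult)
      finally show "(g c u - g c v)\<^sup>2 \<le> \<beta>\<^sup>2 * (2 * (g c u)\<^sup>2 + 2 * \<theta> ^ (2 * r))"
        by (simp add: mult_left_mono)
    qed
    also have "\<dots> = \<beta>\<^sup>2 * (2 * Z u + 2 * (real (card V) * \<theta> ^ (2 * r)))"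
      by (simp add: Z_def sum_distrib_left sum.distrib distrib_left mult_ac)
    also have "\<dots> \<le> \<beta>\<^sup>2 * (4 * Z u)"
      using tail Z_ge[of u] uv E by (intro mult_left_mono) auto
    finally show ?thesis by simp
  qed

  define f where "f c v = (-1) ^ d c v * g c v / sqrt (Z v)" for c v
  show thesis
  proof
    fix v assume v: "v \<in> V"
    have "gram V f v v = (\<Sum>c\<in>V. (g c v)\<^sup>2 / Z v)"
      unfolding gram_def f_def
    proof (rule sum.cong[OF refl])
      fix c
      have "(-1::real) ^ d c v * (-1) ^ d c v = 1" by (simp flip: power_add)
      then have "(-1) ^ d c v * g c v * ((-1) ^ d c v * g c v) = (g c v)\<^sup>2"
        by (simp add: power2_eq_square)
      then show "(-1) ^ d c v * g c v / sqrt (Z v) * ((-1) ^ d c v * g c v / sqrt (Z v)) = (g c v)\<^sup>2 / Z v"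
        using Z_ge[OF v] by simp
    qed
    also have "\<dots> = Z v / Z v" by (simp only: Z_def flip: sum_divide_distrib)
    finally show "gram V f v v = 1" using Z_ge[OF v] by simp
  next
    fix u v assume uv: "(u, v) \<in> E"
    then have vu: "(v, u) \<in> E" using E by (simp add: symD)
    have V': "u \<in> V" "v \<in> V" using uv E by auto
    define s where "s = sqrt (Z u) * sqrt (Z v)"
    have s0: "0 < s" using Z_ge[OF V'(1)] Z_ge[OF V'(2)] by (simp add: s_def)
    have "gram V f u v = (\<Sum>c\<in>V. - (g c u * g c v) / s)"
      unfolding gram_def
    proof (rule sum.cong[OF refl])
      fix c
      show "f c u * f c v = - (g c u * g c v) / s"
      proof (cases "d c u < r \<and> d c v < r")
        case True
        then have "(-1::real) ^ d c u * (-1) ^ d c v = -1"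
          using d_parity[OF uv] by (simp flip: power_add)
        then have "(-1) ^ d c u * g c u * ((-1) ^ d c v * g c v) = - (g c u * g c v)"
          by (metis (no_types, opaque_lifting) mult.assoc mult.left_commute mult_minus1)
        then show ?thesis by (simp add: f_def s_def)
      next
        case False
        then have "g c u * g c v = 0" using d_le[of c u] d_le[of c v] by (auto simp: g_def)
        then show ?thesis by (auto simp: f_def)
      qed
    qed
    also have "\<dots> = - (\<Sum>c\<in>V. g c u * g c v) / s"
      by (simp add: sum_divide_distrib sum_negf)
    finally have gram_eq: "gram V f u v = - (\<Sum>c\<in>V. g c u * g c v) / s" .
    define \<Delta> where "\<Delta> = (\<Sum>c\<in>V. (g c u - g c v)\<^sup>2)"
    have \<Delta>: "\<Delta> \<le> 4 * \<beta>\<^sup>2 * Z u" "\<Delta> \<le> 4 * \<beta>\<^sup>2 * Z v"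
      using diff_le[OF uv] diff_le[OF vu] by (auto simp: \<Delta>_def power2_commute)
    \<comment> \<open>The product of the two bounds gives the geometric mean \<open>s\<close> of \<open>Z u\<close> and \<open>Z v\<close>, which is the
      normalising factor of the inner product.\<close>
    have "\<Delta> * \<Delta> \<le> (4 * \<beta>\<^sup>2 * Z u) * (4 * \<beta>\<^sup>2 * Z v)"
      using \<Delta> by (intro mult_mono) (auto simp: \<Delta>_def Z_def intro!: sum_nonneg mult_nonneg_nonneg)
    also have "\<dots> = (4 * \<beta>\<^sup>2)\<^sup>2 * (Z u * Z v)" by (simp add: power2_eq_square mult_ac)
    also have "Z u * Z v = s\<^sup>2"
      using Z_ge[OF V'(1)] Z_ge[OF V'(2)] by (simp add: s_def power_mult_distrib)
    also have "(4 * \<beta>\<^sup>2)\<^sup>2 * s\<^sup>2 = (4 * \<beta>\<^sup>2 * s)\<^sup>2" by (simp add: power_mult_distrib)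
    finally have "\<Delta>\<^sup>2 \<le> (4 * \<beta>\<^sup>2 * s)\<^sup>2" by (simp add: power2_eq_square)
    then have \<Delta>_le: "\<Delta> \<le> 4 * \<beta>\<^sup>2 * s" by (rule power2_le_imp_le) (use s0 in simp)
    have "\<Delta> = Z u + Z v - 2 * (\<Sum>c\<in>V. g c u * g c v)"
      by (simp add: \<Delta>_def Z_def power2_diff sum.distrib sum_subtractf sum_distrib_left mult.assoc)
    moreover have "2 * s \<le> Z u + Z v"
      using sum_squares_bound[of "sqrt (Z u)" "sqrt (Z v)"] Z_ge[OF V'(1)] Z_ge[OF V'(2)]
      by (simp add: s_def)
    ultimately have "(1 - 2 * \<beta>\<^sup>2) * s \<le> (\<Sum>c\<in>V. g c u * g c v)"
      using \<Delta>_le by (simp add: algebra_simps)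
    then have "1 - 2 * \<beta>\<^sup>2 \<le> (\<Sum>c\<in>V. g c u * g c v) / s"
      using s0 by (simp add: pos_le_divide_eq)
    then show "gram V f u v \<le> - (1 - 2 * \<beta>\<^sup>2)"
      unfolding gram_eq by simp
  qed
qed

section \<open>Odd closed walks and odd cycles\<close>

text \<open>
  A closed walk that repeats a vertex splits there into two shorter closed walks, and one of
  the two has odd length.
\<close>

lemma (in wf_digraph) odd_closed_awalk_imp_odd_cycle:
  assumes "awalk u p u" "odd (length p)"
  shows "\<exists>q. cycle q \<and> odd (length q) \<and> length q \<le> length p \<and> set q \<subseteq> set p"
  using assms
proof (induction "length p" arbitrary: u p rule: less_induct)
  case less
  show ?case
  proof (cases "distinct (tl (awalk_verts u p))")
    case True
    then have "cycle p" using less.prems by (auto simp: cycle_def)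
    then show ?thesis using less.prems by blast
  next
    case False
    then obtain e es where p: "p = e # es" using less.prems by (cases p) auto
    have es: "awalk (head G e) es u" and e: "e \<in> arcs G" "tail G e = u"
      using less.prems by (auto simp: p awalk_Cons_iff)
    have "\<not> distinct (awalk_verts (head G e) es)" using False by (simp add: p)
    from awalk_not_distinct_decomp[OF es this]
    obtain q r s w where qrs: "es = q @ r @ s" "length r > 0"
        "awalk (head G e) q w" "awalk w r w" "awalk w s u"
      by (metis awalk_append_iff length_greater_0_conv)
    have shortcut: "awalk u (e # q @ s) u"
      using qrs e by (auto simp: awalk_Cons_iff intro: awalk_appendI)
    show ?thesis
    proof (cases "odd (length r)")
      case True
      with less.hyps[of r w] qrs p show ?thesis by fastforce
    next
      case False
      then have "odd (length (e # q @ s))" using less.prems by (simp add: p qrs)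
      with less.hyps[OF _ shortcut] qrs p show ?thesis by fastforce
    qed
  qed
qed

lemma (in pair_wf_digraph) relpow_imp_awalk:
  assumes "(u, v) \<in> F ^^ n" "F \<subseteq> parcs G" "u \<in> pverts G"
  shows "\<exists>p. awalk u p v \<and> length p = n \<and> set p \<subseteq> F"
  using assms(1)
proof (induction n arbitrary: v)
  case 0
  then show ?case using assms by (auto simp: awalk_Nil_iff)
next
  case (Suc n)
  then obtain w where w: "(u, w) \<in> F ^^ n" "(w, v) \<in> F" by auto
  then obtain p where p: "awalk u p w" "length p = n" "set p \<subseteq> F" using Suc.IH by blast
  have "awalk w [(w, v)] v" using arc_implies_awalk[of "(w, v)"] w assms by auto
  then have "awalk u (p @ [(w, v)]) v" using p by (intro awalk_appendI)
  then show ?case using p w by (intro exI[of _ "p @ [(w, v)]"]) auto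
qed

section \<open>The bound on the length\<close>

text \<open>
  The parameter \<open>m\<close> is the reciprocal of the step size \<open>\<beta>\<close>. Radius \<open>2 * k * m\<close> suffices for the
  representation since \<open>(1 + 1 / m) ^ m \<ge> 2\<close>, and the hypothesis on \<open>m\<close> says exactly that
  \<open>\<epsilon> = 2 * \<beta>\<^sup>2\<close> makes the vertex count \<open>2 ^ k * (1 + 2 * k * \<epsilon>)\<close> smaller than \<open>2 ^ k + 1\<close>.
\<close>

lemma exists_short_monochromatic_odd_cycle:
  fixes G :: "'a pair_pre_digraph"
  assumes k: "k \<ge> 1" and K: "K\<^bsub>2 ^ k + 1\<^esub> (with_proj G)" and c: "edge_colouring k G c"
    and m: "4 * real k * 2 ^ k < (real m)\<^sup>2"
  shows "\<exists>p. odd_cycle G p \<and> monochromatic c p \<and> length p \<le> 4 * k * m"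
proof -
  define V where "V = pverts G"
  have V: "finite V" "card V = 2 ^ k + 1" and
    parcs: "parcs G = {(u, v). u \<in> V \<and> v \<in> V \<and> u \<noteq> v}"
    using K unfolding complete_digraph_pair_def V_def by auto
  interpret pair_graph G
    using K by (intro pair_graphI_graph) (auto simp: complete_digraph_def)
  have m0: "m > 0"
  proof (rule ccontr)
    assume "\<not> m > 0"
    then have "real k * 2 ^ k < 0" using m by simp
    then show False by (simp add: mult_less_0_iff)
  qed
  define E where "E i = {(u, v) \<in> parcs G. c {u, v} = i}" for i
  define \<beta> where "\<beta> = 1 / real m"
  have \<beta>0: "\<beta> > 0" using m0 by (simp add: \<beta>_def)
  define r where "r = 2 * k * m"
  have col: "c {u, v} < k" if "u \<in> V" "v \<in> V" "u \<noteq> v" for u v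
    using c that unfolding edge_colouring_def uedges_def parcs by force

  have "\<exists>i<k. \<exists>n u. odd n \<and> n < 2 * r \<and> (u, u) \<in> E i ^^ n"
  proof (rule ccontr)
    assume no: "\<not> ?thesis"
    have "1 + real m * \<beta> \<le> (1 + \<beta>) ^ m"
      by (rule Bernoulli_inequality) (use \<beta>0 in linarith)
    then have "2 \<le> (1 + \<beta>) ^ m" using m0 by (simp add: \<beta>_def)
    then have "2 ^ (4 * k) \<le> ((1 + \<beta>) ^ m) ^ (4 * k)" by (intro power_mono) auto
    also have "\<dots> = (1 + \<beta>) ^ (2 * r)" by (simp add: r_def mult_ac flip: power_mult)
    finally have "(2::real) ^ (4 * k) \<le> (1 + \<beta>) ^ (2 * r)" .
    moreover have "4 * real (card V) \<le> 2 ^ (4 * k)"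
    proof -
      have "(8::real) = 2 ^ 3" by simp
      also have "\<dots> \<le> 2 ^ (3 * k)" by (rule power_increasing) (use k in auto)
      finally have "(8::real) \<le> 2 ^ (3 * k)" .
      then have "2 ^ k * 8 \<le> (2::real) ^ k * 2 ^ (3 * k)" by (intro mult_left_mono) auto
      also have "\<dots> = 2 ^ (k + 3 * k)" by (simp only: power_add)
      also have "k + 3 * k = 4 * k" by simp
      finally have "2 ^ k * 8 \<le> (2::real) ^ (4 * k)" .
      moreover have "(1::real) \<le> 2 ^ k" by simp
      moreover have "real (card V) = 2 ^ k + 1" by (simp add: V(2))
      ultimately show ?thesis by linarith
    qed
    ultimately have large: "4 * real (card V) \<le> (1 + \<beta>) ^ (2 * r)" by linarith
    have *: "\<exists>f :: 'a \<Rightarrow> 'a \<Rightarrow> real. (\<forall>v\<in>V. gram V f v v = 1) \<and>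
        (\<forall>(u, v)\<in>E i. gram V f u v \<le> - (1 - 2 * \<beta>\<^sup>2))" if "i < k" for i
    proof -
      have E: "E i \<subseteq> V \<times> V" "sym (E i)"
        by (auto simp: E_def parcs sym_def insert_commute)
      have "(u, u) \<notin> E i ^^ n" if "odd n" "n < 2 * r" for n u
        using no \<open>i < k\<close> that by blast
      from gram_of_no_short_odd_walk[OF V(1) E \<beta>0 this large]
      obtain f :: "'a \<Rightarrow> 'a \<Rightarrow> real" where "\<And>v. v \<in> V \<Longrightarrow> gram V f v v = 1"
        "\<And>u v. (u, v) \<in> E i \<Longrightarrow> gram V f u v \<le> - (1 - 2 * \<beta>\<^sup>2)"
        by blast
      then show ?thesis by blast
    qed
    obtain f :: "nat \<Rightarrow> 'a \<Rightarrow> 'a \<Rightarrow> real"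
      where f: "\<And>i v. i < k \<Longrightarrow> v \<in> V \<Longrightarrow> gram V (f i) v v = 1"
        "\<And>i u v. i < k \<Longrightarrow> (u, v) \<in> E i \<Longrightarrow> gram V (f i) u v \<le> - (1 - 2 * \<beta>\<^sup>2)"
    proof -
      have "\<forall>i. \<exists>h. i < k \<longrightarrow> (\<forall>v\<in>V. gram V h v v = 1) \<and>
          (\<forall>(u, v)\<in>E i. gram V h u v \<le> - (1 - 2 * \<beta>\<^sup>2))"
        using * by blast
      from choice[OF this] obtain f where
        "\<forall>i. i < k \<longrightarrow> (\<forall>v\<in>V. gram V (f i) v v = 1) \<and>
          (\<forall>(u, v)\<in>E i. gram V (f i) u v \<le> - (1 - 2 * \<beta>\<^sup>2))" ..
      then show thesis by (intro that[of f]) auto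
    qed
    have \<beta>2: "4 * real k * 2 ^ k * \<beta>\<^sup>2 < 1"
      using m m0 by (simp add: \<beta>_def power_divide)
    have "4 * real k * 2 * \<beta>\<^sup>2 \<le> 4 * real k * 2 ^ k * \<beta>\<^sup>2"
      using power_increasing[of 1 k "2::real"] k by (intro mult_right_mono mult_left_mono) auto
    with \<beta>2 have "real k * (2 * \<beta>\<^sup>2) \<le> 1/4" by linarith
    moreover have "V \<noteq> {}" using V by auto
    moreover have "gram V (f (c {u, v})) u v \<le> - (1 - 2 * \<beta>\<^sup>2)" if "u \<in> V" "v \<in> V" "u \<noteq> v" for u v
    proof (rule f(2))
      show "c {u, v} < k" by (rule col[OF that])
      show "(u, v) \<in> E (c {u, v})" using that by (simp add: E_def parcs)
    qed
    ultimately have "real (card V) \<le> 2 ^ k * (1 + 2 * real k * (2 * \<beta>\<^sup>2))"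
      using card_le_of_near_antipodal_grams[of V k "2 * \<beta>\<^sup>2" "\<lambda>_. V" f "\<lambda>u v. c {u, v}"]
        V(1) k f(1) col by simp
    also have "\<dots> = 2 ^ k + 4 * real k * 2 ^ k * \<beta>\<^sup>2" by (simp add: algebra_simps)
    also have "\<dots> < real (card V)" using \<beta>2 by (simp add: V(2))
    finally show False by simp
  qed
  then obtain i n u where n: "odd n" "n < 2 * r" "(u, u) \<in> E i ^^ n" by blast
  have "E i \<subseteq> parcs G" by (auto simp: E_def)
  moreover have "u \<in> pverts G"
  proof -
    from n obtain n' where "n = Suc n'" by (cases n) auto
    then show ?thesis using n(3) by (auto simp: E_def parcs V_def)
  qed
  ultimately obtain p where p: "awalk u p u" "length p = n" "set p \<subseteq> E i"
    using relpow_imp_awalk[OF n(3)] by blast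
  with n odd_closed_awalk_imp_odd_cycle[OF p(1)]
  obtain q where q: "cycle q" "odd (length q)" "length q \<le> n" "set q \<subseteq> E i"
    by (metis subset_trans)
  have "length q \<noteq> 1"
  proof
    assume "length q = 1"
    then obtain e where "q = [e]" by (auto simp: length_Suc_conv)
    then show False using q(1) pair_no_loops[of e] by (auto simp: cycle_def awalk_Cons_iff awalk_Nil_iff)
  qed
  then have "3 \<le> length q" using q(2) by presburger
  then have "odd_cycle G q" using q by (simp add: odd_cycle_def)
  moreover have "monochromatic c q"
    using q(4) unfolding monochromatic_def by (intro exI[of _ i]) (auto simp: E_def)
  moreover have "length q \<le> 4 * k * m" using q n by (simp add: r_def)
  ultimately show ?thesis by blast
qed

lemma exists_monochromatic_odd_cycle_le:
  fixes G :: "'a pair_pre_digraph"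
  assumes k: "k \<ge> 1" and K: "K\<^bsub>2 ^ k + 1\<^esub> (with_proj G)" and c: "edge_colouring k G c"
  shows "\<exists>p. odd_cycle G p \<and> monochromatic c p \<and>
    real (length p) \<le> 12 * real k powr (3/2) * 2 powr (real k / 2)"
proof -
  define s where "s = sqrt (real k * 2 ^ k)"
  have s1: "1 \<le> s" unfolding s_def using k by (simp add: mult_ge1_I)
  have s2: "s\<^sup>2 = real k * 2 ^ k" by (simp add: s_def)
  define m where "m = nat \<lfloor>2 * s\<rfloor> + 1"
  have m: "2 * s < real m" "real m \<le> 3 * s" using s1 by (auto simp: m_def) linarith+
  have "(2 * s)\<^sup>2 < (real m)\<^sup>2" using m s1 by (intro power_strict_mono) auto
  then have "4 * real k * 2 ^ k < (real m)\<^sup>2" by (simp add: power_mult_distrib s2)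
  from exists_short_monochromatic_odd_cycle[OF k K c this]
  obtain p where p: "odd_cycle G p" "monochromatic c p" "length p \<le> 4 * k * m" by blast
  have "real (length p) \<le> real (4 * k * m)" using p(3) by (rule of_nat_mono)
  also have "\<dots> = 4 * real k * real m" by simp
  also have "\<dots> \<le> 4 * real k * (3 * s)" using m by (intro mult_left_mono) auto
  also have "\<dots> = 12 * (real k * s)" by simp
  also have "s = real k powr (1/2) * 2 powr (real k / 2)"
    by (simp add: s_def real_sqrt_mult powr_half_sqrt powr_half_sqrt_powr powr_realpow)
  also have "real k * (real k powr (1/2) * 2 powr (real k / 2)) = real k powr (3/2) * 2 powr (real k / 2)"
    using k powr_mult_base[of "real k" "1/2"] by simp
  finally show ?thesis using p by (auto simp: mult.assoc)
qed

theorem theorem1p4: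
  shows "(\<exists>C::real. C > 0 \<and>
           (\<forall>k\<ge>1. \<forall>(G :: nat pair_pre_digraph) c.
              K\<^bsub>2 ^ k + 1\<^esub> (with_proj G) \<longrightarrow> edge_colouring k G c \<longrightarrow>
              (\<exists>p. odd_cycle G p \<and> monochromatic c p \<and>
                   real (length p) \<le> C * real k powr (3/2) * 2 powr (real k / 2)))) \<and>
         (\<lambda>k. real (L k)) \<in> O(\<lambda>k. real k powr (3/2) * 2 powr (real k / 2))"
proof
  show "\<exists>C::real. C > 0 \<and>
           (\<forall>k\<ge>1. \<forall>(G :: nat pair_pre_digraph) c.
              K\<^bsub>2 ^ k + 1\<^esub> (with_proj G) \<longrightarrow> edge_colouring k G c \<longrightarrow>
              (\<exists>p. odd_cycle G p \<and> monochromatic c p \<and>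
                   real (length p) \<le> C * real k powr (3/2) * 2 powr (real k / 2)))"
    using exists_monochromatic_odd_cycle_le by (intro exI[of _ 12]) auto
  show "(\<lambda>k. real (L k)) \<in> O(\<lambda>k. real k powr (3/2) * 2 powr (real k / 2))"
  proof (rule bigoI[of _ 12])
    show "\<forall>\<^sub>F k in at_top. norm (real (L k)) \<le> 12 * norm (real k powr (3/2) * 2 powr (real k / 2))"
      using eventually_ge_at_top[of 1]
    proof eventually_elim
      case (elim k)
      define B where "B = 12 * real k powr (3/2) * 2 powr (real k / 2)"
      have B0: "0 \<le> B" by (simp add: B_def)
      have "L k \<le> nat \<lfloor>B\<rfloor>"
        unfolding L_def
      proof (rule Least_le, intro allI impI)
        fix G :: "nat pair_pre_digraph" and c
        assume "K\<^bsub>2 ^ k + 1\<^esub> (with_proj G)" "edge_colouring k G c"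
        from exists_monochromatic_odd_cycle_le[OF elim this]
        show "\<exists>p. odd_cycle G p \<and> monochromatic c p \<and> length p \<le> nat \<lfloor>B\<rfloor>"
          unfolding B_def[symmetric] by (auto simp: le_nat_iff le_floor_iff)
      qed
      then have "real (L k) \<le> B" using B0 by linarith
      then show ?case by (simp add: B_def mult.assoc)
    qed
  qed
qed

end
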